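(* Let $S$ be a string of length $n$ over an alphabet $\Sigma$. For every character $\sigma\in\Sigma$, the $3$-sub-cadences of $S$ with $\sigma$ can be counted in $\mathcal{O}(n\log n)$ time. Also, if all $n_\sigma$ occurrences of $\sigma$ in $S$ are known, the $3$-sub-cadences with $\sigma$ can be counted in $\mathcal{O}(n_\sigma^2)$ time.
   Context: A string $S=S[1]S[2]\cdots S[n]$ is a sequence of characters from $\Sigma$. A $3$-sub-cadence of $S$ is a triple $(i,d,3)$ with positive integers $i,d$ such that $i+2d\le n$ and $S[i]=S[i+d]=S[i+2d]$; it is a $3$-sub-cadence with $\sigma$ if this common character is $\sigma$. Computational model: arithmetic operations on integers with $\mathcal{O}(\log n)$ bits take constant time; each character $S[j]$ can be read in constant time; characters are sufficiently small integers. The standard fact that the acyclic convolution of two sequences of length $m$ can be computed in $\mathcal{O}(m\log m)$ operations is assumed. Constants in $\mathcal{O}$ are absolute. *)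

theory Defs
  imports Complex_Main "HOL-Library.Landau_Symbols"
begin

section \<open>Strings and 3-sub-cadences\<close>

text \<open>Positions in strings are counted from 1.\<close>

definition char_at :: "'a list \<Rightarrow> nat \<Rightarrow> 'a" where
  "char_at S i = S ! (i - 1)"

definition sub_cadence3 :: "'a list \<Rightarrow> nat \<times> nat \<times> nat \<Rightarrow> bool" where
  "sub_cadence3 S = (\<lambda>(i, d, p). p = 3 \<and> 1 \<le> i \<and> 1 \<le> d \<and> i + 2 * d \<le> length S \<and>
     char_at S i = char_at S (i + d) \<and> char_at S (i + d) = char_at S (i + 2 * d))"

definition sub_cadences3_with :: "'a list \<Rightarrow> 'a \<Rightarrow> (nat \<times> nat \<times> nat) set" where
  "sub_cadences3_with S \<sigma> = {(i, d, p). sub_cadence3 S (i, d, p) \<and> char_at S i = \<sigma>}"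

definition occurrences :: "'a list \<Rightarrow> 'a \<Rightarrow> nat set" where
  "occurrences S \<sigma> = {j. 1 \<le> j \<and> j \<le> length S \<and> char_at S j = \<sigma>}"


section \<open>A unit-cost random access machine with bounded integers\<close>

text \<open>
  Programs are while-programs over integer variables and integer arrays, both named by natural
  numbers. Every arithmetic or Boolean operation, variable access, array access, assignment, and
  test costs one unit. A program mentions only finitely many variables and arrays, so this is a
  structured form of the random access machine.

  The parameter \<open>w\<close> bounds the magnitude of integers: an expression can be evaluated only if the
  values of all its subexpressions (array indices included) have absolute value at most \<open>w\<close>.
  Otherwise execution is stuck. Taking \<open>w\<close> polynomial in \<open>n\<close> restricts the machine to
  integers with \<open>O(log n)\<close> bits.
\<close>

datatype aop = Plus | Minus | Times | Div | Mod

datatype aexp =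
    Const int
  | Var nat
  | Get nat aexp  \<comment> \<open>array name, index\<close>
  | Bin aop aexp aexp

datatype bexp =
    Less aexp aexp
  | Equal aexp aexp
  | Neg bexp
  | Conj bexp bexp

datatype com =
    Skip
  | Assign nat aexp
  | Put nat aexp aexp  \<comment> \<open>array name, index, new value\<close>
  | Seq com com
  | Cond bexp com com
  | While bexp com

type_synonym state = "(nat \<Rightarrow> int) \<times> (nat \<Rightarrow> int \<Rightarrow> int)"  \<comment> \<open>variables, arrays\<close>

fun apply_aop :: "aop \<Rightarrow> int \<Rightarrow> int \<Rightarrow> int" where
  "apply_aop Plus x y = x + y"
| "apply_aop Minus x y = x - y"
| "apply_aop Times x y = x * y"
| "apply_aop Div x y = x div y"
| "apply_aop Mod x y = x mod y"

fun aval :: "state \<Rightarrow> aexp \<Rightarrow> int" where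
  "aval s (Const c) = c"
| "aval s (Var x) = fst s x"
| "aval s (Get a e) = snd s a (aval s e)"
| "aval s (Bin f e1 e2) = apply_aop f (aval s e1) (aval s e2)"

fun bval :: "state \<Rightarrow> bexp \<Rightarrow> bool" where
  "bval s (Less e1 e2) \<longleftrightarrow> aval s e1 < aval s e2"
| "bval s (Equal e1 e2) \<longleftrightarrow> aval s e1 = aval s e2"
| "bval s (Neg b) \<longleftrightarrow> \<not> bval s b"
| "bval s (Conj b1 b2) \<longleftrightarrow> bval s b1 \<and> bval s b2"

fun afits :: "int \<Rightarrow> state \<Rightarrow> aexp \<Rightarrow> bool" where
  "afits w s (Const c) \<longleftrightarrow> \<bar>c\<bar> \<le> w"
| "afits w s (Var x) \<longleftrightarrow> \<bar>fst s x\<bar> \<le> w"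
| "afits w s (Get a e) \<longleftrightarrow> afits w s e \<and> \<bar>aval s (Get a e)\<bar> \<le> w"
| "afits w s (Bin f e1 e2) \<longleftrightarrow> afits w s e1 \<and> afits w s e2 \<and> \<bar>aval s (Bin f e1 e2)\<bar> \<le> w"

fun bfits :: "int \<Rightarrow> state \<Rightarrow> bexp \<Rightarrow> bool" where
  "bfits w s (Less e1 e2) \<longleftrightarrow> afits w s e1 \<and> afits w s e2"
| "bfits w s (Equal e1 e2) \<longleftrightarrow> afits w s e1 \<and> afits w s e2"
| "bfits w s (Neg b) \<longleftrightarrow> bfits w s b"
| "bfits w s (Conj b1 b2) \<longleftrightarrow> bfits w s b1 \<and> bfits w s b2"

fun acost :: "aexp \<Rightarrow> nat" where
  "acost (Const c) = 1"
| "acost (Var x) = 1"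
| "acost (Get a e) = 1 + acost e"
| "acost (Bin f e1 e2) = 1 + acost e1 + acost e2"

fun bcost :: "bexp \<Rightarrow> nat" where
  "bcost (Less e1 e2) = 1 + acost e1 + acost e2"
| "bcost (Equal e1 e2) = 1 + acost e1 + acost e2"
| "bcost (Neg b) = 1 + bcost b"
| "bcost (Conj b1 b2) = 1 + bcost b1 + bcost b2"

text \<open>\<open>exec w c s t s'\<close>: started in \<open>s\<close>, \<open>c\<close> terminates in \<open>s'\<close> after exactly \<open>t\<close> units of time.\<close>

inductive exec :: "int \<Rightarrow> com \<Rightarrow> state \<Rightarrow> nat \<Rightarrow> state \<Rightarrow> bool" for w :: int where
  Skip: "exec w Skip s 1 s"
| Assign: "afits w s e \<Longrightarrow>
    exec w (Assign x e) s (1 + acost e) ((fst s)(x := aval s e), snd s)"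
| Put: "afits w s i \<Longrightarrow> afits w s e \<Longrightarrow>
    exec w (Put a i e) s (1 + acost i + acost e)
      (fst s, (snd s)(a := (snd s a)(aval s i := aval s e)))"
| Seq: "exec w c1 s t1 s1 \<Longrightarrow> exec w c2 s1 t2 s2 \<Longrightarrow> exec w (Seq c1 c2) s (t1 + t2) s2"
| CondTrue: "bfits w s b \<Longrightarrow> bval s b \<Longrightarrow> exec w c1 s t s' \<Longrightarrow>
    exec w (Cond b c1 c2) s (1 + bcost b + t) s'"
| CondFalse: "bfits w s b \<Longrightarrow> \<not> bval s b \<Longrightarrow> exec w c2 s t s' \<Longrightarrow>
    exec w (Cond b c1 c2) s (1 + bcost b + t) s'"
| WhileFalse: "bfits w s b \<Longrightarrow> \<not> bval s b \<Longrightarrow> exec w (While b c) s (1 + bcost b) s"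
| WhileTrue: "bfits w s b \<Longrightarrow> bval s b \<Longrightarrow> exec w c s t1 s1 \<Longrightarrow> exec w (While b c) s1 t2 s2 \<Longrightarrow>
    exec w (While b c) s (1 + bcost b + t1 + t2) s2"

inductive_cases exec_SkipE: "exec w Skip s t s'"
  and exec_AssignE: "exec w (Assign x e) s t s'"
  and exec_PutE: "exec w (Put a i e) s t s'"
  and exec_SeqE: "exec w (Seq c1 c2) s t s'"
  and exec_CondE: "exec w (Cond b c1 c2) s t s'"
  and exec_WhileE: "exec w (While b c) s t s'"

lemma exec_deterministic:
  "exec w c s t s' \<Longrightarrow> exec w c s u s'' \<Longrightarrow> u = t \<and> s'' = s'"
proof (induction arbitrary: u s'' rule: exec.induct)
  case Skip
  then show ?case by (rule exec_SkipE) simp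
next
  case Assign
  from Assign.prems show ?case by (rule exec_AssignE) simp
next
  case Put
  from Put.prems show ?case by (rule exec_PutE) simp
next
  case (Seq c1 s t1 s1 c2 t2 s2)
  obtain v1 r1 v2 where *: "exec w c1 s v1 r1" "exec w c2 r1 v2 s''" "u = v1 + v2"
    using Seq.prems by (rule exec_SeqE)
  have "v1 = t1 \<and> r1 = s1" using *(1) by (rule Seq.IH(1))
  moreover from this have "v2 = t2 \<and> s'' = s2" using *(2) Seq.IH(2) by simp
  ultimately show ?case using *(3) by simp
next
  case (CondTrue s b c1 t s' c2)
  obtain v where "exec w c1 s v s''" "u = 1 + bcost b + v"
    using CondTrue.prems by (rule exec_CondE) (use CondTrue.hyps in simp_all)
  then show ?case using CondTrue.IH by simp
next
  case (CondFalse s b c2 t s' c1)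
  obtain v where "exec w c2 s v s''" "u = 1 + bcost b + v"
    using CondFalse.prems by (rule exec_CondE) (use CondFalse.hyps in simp_all)
  then show ?case using CondFalse.IH by simp
next
  case (WhileFalse s b c)
  show ?case
    using WhileFalse.prems by (rule exec_WhileE) (use WhileFalse.hyps in simp_all)
next
  case (WhileTrue s b c t1 s1 t2 s2)
  obtain v1 r1 v2 where *: "exec w c s v1 r1" "exec w (While b c) r1 v2 s''"
    "u = 1 + bcost b + v1 + v2"
    using WhileTrue.prems by (rule exec_WhileE) (use WhileTrue.hyps in simp_all)
  have "v1 = t1 \<and> r1 = s1" using *(1) by (rule WhileTrue.IH(1))
  moreover from this have "v2 = t2 \<and> s'' = s2" using *(2) WhileTrue.IH(2) by simp
  ultimately show ?case using *(3) by simp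
qed

definition runs_within :: "int \<Rightarrow> nat \<Rightarrow> com \<Rightarrow> state \<Rightarrow> (state \<Rightarrow> bool) \<Rightarrow> bool" where
  "runs_within w t c s Q \<longleftrightarrow> (\<exists>t'\<le>t. \<exists>s'. exec w c s t' s' \<and> Q s')"


section \<open>Acyclic convolution\<close>

definition acyclic_convolution :: "int list \<Rightarrow> int list \<Rightarrow> nat \<Rightarrow> int" where
  "acyclic_convolution a b l =
     (\<Sum>(i, j)\<in>{(i, j). i < length a \<and> j < length b \<and> i + j = l}. a ! i * b ! j)"

text \<open>
  The assumed fact: two integer sequences of length \<open>m\<close> whose entries have \<open>O(log m)\<close> bits can be
  convolved in \<open>O(m log m)\<close> operations on integers with \<open>O(log m)\<close> bits. The length is passed in
  variable 0, the sequences in arrays 0 and 1, and the result is returned in array 2. All other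
  memory cells may initially have arbitrary contents.
\<close>

definition convolution_input :: "int list \<Rightarrow> int list \<Rightarrow> state \<Rightarrow> bool" where
  "convolution_input a b s \<longleftrightarrow> fst s 0 = int (length a) \<and>
     (\<forall>i<length a. snd s 0 (int i) = a ! i) \<and> (\<forall>i<length b. snd s 1 (int i) = b ! i)"

definition fast_convolution :: bool where
  "fast_convolution \<longleftrightarrow>
    (\<forall>k. \<exists>P T k'. (\<lambda>m. real (T m)) \<in> O(\<lambda>m. real m * ln (real m)) \<and>
      (\<forall>a b s m. length a = m \<longrightarrow> length b = m \<longrightarrow>
        (\<forall>x\<in>set a \<union> set b. \<bar>x\<bar> \<le> (int m + 2) ^ k) \<longrightarrow> convolution_input a b s \<longrightarrow>
        runs_within ((int m + 2) ^ k') (T m) P s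
          (\<lambda>s'. \<forall>l. l + 1 < 2 * m \<longrightarrow> snd s' 2 (int l) = acyclic_convolution a b l)))"


section \<open>Passing strings to programs\<close>

text \<open>
  The length of the string is passed in variable 0, the character in variable 1, and the string
  in cells \<open>1, \<dots>, n\<close> of array 0. If the occurrences of the character are known, their
  number is passed in variable 2 and they are listed in array 1, starting with cell 0. Again, all
  other memory cells may initially have arbitrary contents.
\<close>

definition string_input :: "int list \<Rightarrow> int \<Rightarrow> state \<Rightarrow> bool" where
  "string_input S \<sigma> s \<longleftrightarrow> fst s 0 = int (length S) \<and> fst s 1 = \<sigma> \<and>
     (\<forall>j. 1 \<le> j \<and> j \<le> length S \<longrightarrow> snd s 0 (int j) = char_at S j)"

definition occurrences_input :: "nat list \<Rightarrow> state \<Rightarrow> bool" where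
  "occurrences_input ps s \<longleftrightarrow> fst s 2 = int (length ps) \<and>
     (\<forall>i<length ps. snd s 1 (int i) = int (ps ! i))"

text \<open>The result is returned in variable 0.\<close>

definition returns_count3 :: "int list \<Rightarrow> int \<Rightarrow> state \<Rightarrow> bool" where
  "returns_count3 S \<sigma> s \<longleftrightarrow> fst s 0 = int (card (sub_cadences3_with S \<sigma>))"

text \<open>Characters are integers with \<open>O(log n)\<close> bits.\<close>

definition small_alphabet :: "nat \<Rightarrow> nat \<Rightarrow> int set \<Rightarrow> bool" where
  "small_alphabet k n A \<longleftrightarrow> (\<forall>c\<in>A. \<bar>c\<bar> \<le> (int n + 2) ^ k)"

end

theory Submission
  imports Defs "HOL-Real_Asymp.Real_Asymp"
begin

text \<open>
  A 3-sub-cadence with \<open>\<sigma>\<close> is determined by its middle occurrence \<open>y\<close> and its first occurrence \<open>x\<close>: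
  it exists iff \<open>x < y\<close> and the reflected position \<open>2 * y - x\<close> is an occurrence as well. Testing this
  for all pairs of known occurrences takes quadratic time. On the other hand, the convolution of the
  indicator sequence of the occurrences with itself counts at \<open>2 * y\<close> all pairs of occurrences that
  are symmetric about \<open>y\<close>: the pair \<open>(y, y)\<close>, and every 3-sub-cadence with middle \<open>y\<close> twice.
\<close>

section \<open>Reasoning about running times\<close>

text \<open>The bound \<open>w\<close> enters the rules only as an upper limit on absolute values,
  so every derivation survives enlarging it. This allows programs that come with different word
  bounds to be combined.\<close>

lemma exec_mono: "exec w c s t s' \<Longrightarrow> w \<le> w' \<Longrightarrow> exec w' c s t s'"
proof -
  have afits: "afits w s e \<Longrightarrow> w \<le> w' \<Longrightarrow> afits w' s e" for s e
    by (induction e) auto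
  have bfits: "bfits w s b \<Longrightarrow> w \<le> w' \<Longrightarrow> bfits w' s b" for s b
    by (induction b) (auto intro: afits)
  show "exec w c s t s' \<Longrightarrow> w \<le> w' \<Longrightarrow> exec w' c s t s'"
    by (induction rule: exec.induct) (rule exec.intros; auto intro: afits bfits)+
qed

lemma runs_within_mono:
  assumes "runs_within w t c s Q" "w \<le> w'" "t \<le> t'" "\<And>s'. Q s' \<Longrightarrow> Q' s'"
  shows "runs_within w' t' c s Q'"
  using assms unfolding runs_within_def by (meson exec_mono le_trans)

lemma runs_within_Cond:
  assumes "bfits w s b"
    and "bval s b \<Longrightarrow> runs_within w t1 c1 s Q" "\<not> bval s b \<Longrightarrow> runs_within w t2 c2 s Q"
  shows "runs_within w (1 + bcost b + max t1 t2) (Cond b c1 c2) s Q"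
proof (cases "bval s b")
  case True
  then obtain t s' where *: "t \<le> t1" "exec w c1 s t s'" "Q s'"
    using assms(2) unfolding runs_within_def by blast
  have "exec w (Cond b c1 c2) s (1 + bcost b + t) s'"
    using assms(1) True *(2) by (rule exec.CondTrue)
  moreover have "1 + bcost b + t \<le> 1 + bcost b + max t1 t2"
    using *(1) by simp
  ultimately show ?thesis
    unfolding runs_within_def using *(3) by blast
next
  case False
  then obtain t s' where *: "t \<le> t2" "exec w c2 s t s'" "Q s'"
    using assms(3) unfolding runs_within_def by blast
  have "exec w (Cond b c1 c2) s (1 + bcost b + t) s'"
    using assms(1) False *(2) by (rule exec.CondFalse)
  moreover have "1 + bcost b + t \<le> 1 + bcost b + max t1 t2"
    using *(1) by simp
  ultimately show ?thesis
    unfolding runs_within_def using *(3) by blast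
qed

lemma runs_within_Seq:
  assumes "runs_within w t1 c1 s R" "\<And>s'. R s' \<Longrightarrow> runs_within w t2 c2 s' Q"
  shows "runs_within w (t1 + t2) (Seq c1 c2) s Q"
proof -
  obtain u1 s1 where 1: "u1 \<le> t1" "exec w c1 s u1 s1" "R s1"
    using assms(1) unfolding runs_within_def by blast
  obtain u2 s2 where 2: "u2 \<le> t2" "exec w c2 s1 u2 s2" "Q s2"
    using assms(2)[OF 1(3)] unfolding runs_within_def by blast
  show ?thesis
    unfolding runs_within_def using 1 2 by (meson add_mono exec.Seq)
qed

text \<open>The invariant is indexed by the number of completed iterations. The summand outside the
  product with \<open>N\<close> pays for the final, failing test.\<close>

lemma runs_within_While:
  assumes step: "\<And>i s. i < N \<Longrightarrow> I i s \<Longrightarrow>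
      bfits w s b \<and> bval s b \<and> runs_within w t c s (I (Suc i))"
    and exit: "\<And>s. I N s \<Longrightarrow> bfits w s b \<and> \<not> bval s b"
    and init: "I 0 s"
  shows "runs_within w (N * (1 + bcost b + t) + (1 + bcost b)) (While b c) s (I N)"
proof -
  \<comment> \<open>Induction on the number \<open>k\<close> of remaining iterations; the invariant
    index is therefore \<open>N - k\<close>.\<close>
  have "runs_within w (k * (1 + bcost b + t) + (1 + bcost b)) (While b c) s (I N)"
    if "k \<le> N" "I (N - k) s" for k s
    using that
  proof (induction k arbitrary: s)
    case 0
    then have "exec w (While b c) s (1 + bcost b) s" "I N s"
      using exit[of s] exec.WhileFalse[of w s b c] by simp_all
    then show ?case
      unfolding runs_within_def mult_0 add_0 by blast
  next
    case (Suc k)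
    have Suc_diff: "Suc (N - Suc k) = N - k"
      using Suc.prems(1) by simp
    have b: "bfits w s b" "bval s b" and body: "runs_within w t c s (I (N - k))"
      using step[OF _ Suc.prems(2)] Suc.prems(1) unfolding Suc_diff by auto
    obtain u1 s1 where 1: "u1 \<le> t" "exec w c s u1 s1" "I (N - k) s1"
      using body unfolding runs_within_def by blast
    obtain u2 s2 where 2: "u2 \<le> k * (1 + bcost b + t) + (1 + bcost b)"
      "exec w (While b c) s1 u2 s2" "I N s2"
      using Suc.IH[OF _ 1(3)] Suc.prems(1) unfolding runs_within_def by auto
    have "exec w (While b c) s (1 + bcost b + u1 + u2) s2"
      using b 1(2) 2(2) by (rule exec.WhileTrue)
    moreover have "1 + bcost b + u1 + u2 \<le> Suc k * (1 + bcost b + t) + (1 + bcost b)"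
      using 1(1) 2(1) by simp
    ultimately show ?case
      unfolding runs_within_def using 2(3) by blast
  qed
  from this[of N s] show ?thesis using init by simp
qed

text \<open>Both functions are meant for loop-free programs: a loop has precondition \<open>False\<close> and a
  meaningless time.\<close>

fun wp :: "int \<Rightarrow> com \<Rightarrow> state \<Rightarrow> (state \<Rightarrow> bool) \<Rightarrow> bool" where
  "wp w Skip s Q \<longleftrightarrow> Q s"
| "wp w (Assign x e) s Q \<longleftrightarrow> afits w s e \<and> Q ((fst s)(x := aval s e), snd s)"
| "wp w (Put a i e) s Q \<longleftrightarrow> afits w s i \<and> afits w s e \<and>
     Q (fst s, (snd s)(a := (snd s a)(aval s i := aval s e)))"
| "wp w (Seq c1 c2) s Q \<longleftrightarrow> wp w c1 s (\<lambda>s'. wp w c2 s' Q)"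
| "wp w (Cond b c1 c2) s Q \<longleftrightarrow> bfits w s b \<and> (if bval s b then wp w c1 s Q else wp w c2 s Q)"
| "wp w (While b c) s Q \<longleftrightarrow> False"

fun loop_free_time :: "com \<Rightarrow> nat" where
  "loop_free_time Skip = 1"
| "loop_free_time (Assign x e) = 1 + acost e"
| "loop_free_time (Put a i e) = 1 + acost i + acost e"
| "loop_free_time (Seq c1 c2) = loop_free_time c1 + loop_free_time c2"
| "loop_free_time (Cond b c1 c2) = 1 + bcost b + max (loop_free_time c1) (loop_free_time c2)"
| "loop_free_time (While b c) = 0"

lemma runs_within_wp: "wp w c s Q \<Longrightarrow> runs_within w (loop_free_time c) c s Q"
proof (induction c arbitrary: s Q)
  case Skip
  then show ?case
    unfolding runs_within_def wp.simps loop_free_time.simps using exec.Skip by blast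
next
  case (Assign x e)
  then show ?case
    unfolding runs_within_def wp.simps loop_free_time.simps using exec.Assign by blast
next
  case (Put a i e)
  then show ?case
    unfolding runs_within_def wp.simps loop_free_time.simps using exec.Put by blast
next
  case (Seq c1 c2)
  from Seq.prems have "runs_within w (loop_free_time c1) c1 s (\<lambda>s'. wp w c2 s' Q)"
    by (simp add: Seq.IH(1))
  then show ?case
    unfolding loop_free_time.simps using Seq.IH(2) by (rule runs_within_Seq)
next
  case (Cond b c1 c2)
  show ?case
    unfolding loop_free_time.simps using Cond by (intro runs_within_Cond) auto
qed simp

lemma wp_mono: "wp w c s Q \<Longrightarrow> (\<And>s'. Q s' \<Longrightarrow> Q' s') \<Longrightarrow> wp w c s Q'"
  by (induction w c s Q arbitrary: Q' rule: wp.induct) (auto split: if_splits)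

section \<open>Frame properties: memory that a program does not assign to\<close>

fun assigned_vars :: "com \<Rightarrow> nat set" where
  "assigned_vars (Assign x e) = {x}"
| "assigned_vars (Seq c1 c2) = assigned_vars c1 \<union> assigned_vars c2"
| "assigned_vars (Cond b c1 c2) = assigned_vars c1 \<union> assigned_vars c2"
| "assigned_vars (While b c) = assigned_vars c"
| "assigned_vars _ = {}"

fun assigned_arrays :: "com \<Rightarrow> nat set" where
  "assigned_arrays (Put a i e) = {a}"
| "assigned_arrays (Seq c1 c2) = assigned_arrays c1 \<union> assigned_arrays c2"
| "assigned_arrays (Cond b c1 c2) = assigned_arrays c1 \<union> assigned_arrays c2"
| "assigned_arrays (While b c) = assigned_arrays c"
| "assigned_arrays _ = {}"

lemma finite_assigned: "finite (assigned_vars c)" "finite (assigned_arrays c)"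
  by (induction c) auto

lemma exec_frame:
  assumes "exec w c s t s'"
  shows "x \<notin> assigned_vars c \<Longrightarrow> fst s' x = fst s x"
    and "a \<notin> assigned_arrays c \<Longrightarrow> snd s' a = snd s a"
  using assms by (induction rule: exec.induct) auto

text \<open>This makes it possible to call an unknown program as a black box: data stored under
  names that it never assigns is still there afterwards.\<close>

lemma runs_within_frame:
  assumes "runs_within w t c s Q"
  shows "runs_within w t c s (\<lambda>s'. Q s' \<and> (\<forall>x. x \<notin> assigned_vars c \<longrightarrow> fst s' x = fst s x) \<and>
    (\<forall>a. a \<notin> assigned_arrays c \<longrightarrow> snd s' a = snd s a))"
  using assms unfolding runs_within_def by (metis exec_frame)


section \<open>Counting 3-sub-cadences by their middle position\<close>

text \<open>For \<open>y\<close> in \<open>X\<close> these are the first elements of the nontrivial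
  three-term arithmetic progressions in \<open>X\<close> with middle \<open>y\<close>. The condition
  \<open>x < y\<close> keeps the subtraction from truncating.\<close>

definition left_partners :: "nat set \<Rightarrow> nat \<Rightarrow> nat set" where
  "left_partners X y = {x \<in> X. x < y \<and> 2 * y - x \<in> X}"

lemma finite_occurrences [simp]: "finite (occurrences S \<sigma>)"
  by (rule finite_subset[of _ "{..length S}"]) (auto simp: occurrences_def)

text \<open>Recording the middle position instead of the distance is a bijection:
  \<open>(i, d, 3)\<close> corresponds to the middle \<open>i + d\<close> together with the left
  partner \<open>i\<close>.\<close>

lemma card_sub_cadences3_with:
  "card (sub_cadences3_with S \<sigma>) =
     (\<Sum>y\<in>occurrences S \<sigma>. card (left_partners (occurrences S \<sigma>) y))"
proof -
  let ?X = "occurrences S \<sigma>"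
  let ?D = "SIGMA y:?X. left_partners ?X y"
  have "bij_betw (\<lambda>(y, x). (x, y - x, 3)) ?D (sub_cadences3_with S \<sigma>)"
  proof (rule bij_betw_byWitness[where f' = "\<lambda>(i, d, p). (i + d, i)"])
    show "(\<lambda>(y, x). (x, y - x, 3)) ` ?D \<subseteq> sub_cadences3_with S \<sigma>"
      by (auto simp: left_partners_def occurrences_def sub_cadences3_with_def sub_cadence3_def
          diff_mult_distrib2 mult_2)
  qed (auto simp: left_partners_def occurrences_def sub_cadences3_with_def sub_cadence3_def)
  then have "card ?D = card (sub_cadences3_with S \<sigma>)"
    by (rule bij_betw_same_card)
  then show ?thesis
    by (simp add: left_partners_def)
qed

text \<open>Cell \<open>i\<close> of the list stands for position \<open>i + 1\<close>, so pairs of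
  positions with sum \<open>2 * y\<close> are met at index \<open>2 * (y - 1)\<close>. The
  convolution counts ordered pairs, hence the factor 2 and the single extra pair
  \<open>(y, y)\<close>.\<close>

lemma acyclic_convolution_indicator:
  fixes X :: "nat set" and n :: nat
  defines "a \<equiv> map (\<lambda>i. of_bool (Suc i \<in> X)) [0..<n]"
  assumes X: "X \<subseteq> {1..n}" and y: "y \<in> X"
  shows "acyclic_convolution a a (2 * (y - 1)) = 1 + 2 * int (card (left_partners X y))"
proof -
  let ?L = "left_partners X y"
  let ?I = "{(i, j). i < n \<and> j < n \<and> i + j = 2 * (y - 1)}"
  let ?E = "{(i, j). (i, j) \<in> ?I \<and> Suc i \<in> X \<and> Suc j \<in> X}"
  have fin: "finite X"
    using X by (rule finite_subset) simp
  have finI: "finite ?I"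
    by (rule finite_subset[of _ "{..<n} \<times> {..<n}"]) auto
  have range: "1 \<le> x \<and> x \<le> n" if "x \<in> X" for x
    using X that by auto
  have "acyclic_convolution a a (2 * (y - 1)) = (\<Sum>(i, j)\<in>?I. of_bool (Suc i \<in> X \<and> Suc j \<in> X))"
    unfolding acyclic_convolution_def a_def by (intro sum.cong) auto
  also have "\<dots> = (\<Sum>p\<in>?I. if p \<in> ?E then 1 else 0)"
    by (intro sum.cong) auto
  also have "\<dots> = int (card ?E)"
    using finI by (subst sum.inter_restrict[symmetric]) (auto intro!: arg_cong[where f = card])
  \<comment> \<open>As the sum is fixed, a pair is determined by its first position. That position
    is \<open>y\<close>, or a left partner of \<open>y\<close>, or the mirror image of a left
    partner.\<close>
  also have "card ?E = card ({y} \<union> ?L \<union> (\<lambda>x. 2 * y - x) ` ?L)"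
  proof (rule bij_betw_same_card)
    have pos: "1 \<le> y"
      using range[OF y] by simp
    have Suc_pred: "Suc (x - Suc 0) = x" if "x \<in> X" for x
      using range[OF that] by simp
    show "bij_betw (\<lambda>(i, j). Suc i) ?E ({y} \<union> ?L \<union> (\<lambda>x. 2 * y - x) ` ?L)"
    proof (rule bij_betw_byWitness[where f' = "\<lambda>x. (x - 1, 2 * y - x - 1)"])
      show "(\<lambda>(i, j). Suc i) ` ?E \<subseteq> {y} \<union> ?L \<union> (\<lambda>x. 2 * y - x) ` ?L"
      proof clarify
        fix i j
        assume *: "i + j = 2 * (y - 1)" "Suc i \<in> X" "Suc j \<in> X"
          "Suc i \<notin> (\<lambda>x. 2 * y - x) ` ?L" "Suc i \<notin> ?L"
        have "2 * y - Suc i = Suc j" and ij: "2 * y - Suc j = Suc i"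
          using *(1) pos by linarith+
        have "\<not> Suc i < y"
          using * \<open>2 * y - Suc i = Suc j\<close> by (auto simp: left_partners_def)
        moreover have "\<not> Suc j < y"
        proof
          assume "Suc j < y"
          then have "Suc j \<in> ?L"
            using * ij by (simp add: left_partners_def)
          then show False
            using *(4) ij by force
        qed
        ultimately show "Suc i = y"
          using *(1) pos by simp
      qed
      show "(\<lambda>x. (x - 1, 2 * y - x - 1)) ` ({y} \<union> ?L \<union> (\<lambda>x. 2 * y - x) ` ?L) \<subseteq> ?E"
      proof
        fix p
        assume "p \<in> (\<lambda>x. (x - 1, 2 * y - x - 1)) ` ({y} \<union> ?L \<union> (\<lambda>x. 2 * y - x) ` ?L)"
        then obtain x where p: "p = (x - 1, 2 * y - x - 1)"
          and x: "x \<in> {y} \<union> ?L \<union> (\<lambda>x. 2 * y - x) ` ?L"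
          by blast
        have "x \<in> X" and "2 * y - x \<in> X"
          using x y by (auto simp: left_partners_def)
        then have le: "1 \<le> x" "x \<le> n" "1 \<le> 2 * y - x" "2 * y - x \<le> n"
          using range by blast+
        obtain i where i: "x = Suc i"
          using le(1) by (cases x) auto
        obtain j where j: "2 * y - x = Suc j"
          using le(3) by (cases "2 * y - x") auto
        have "p = (i, j)"
          unfolding p j by (simp add: i)
        moreover have "i < n" "j < n" "i + j = 2 * (y - 1)"
          using le i j by linarith+
        moreover have "Suc i \<in> X" "Suc j \<in> X"
          unfolding i[symmetric] j[symmetric] by fact+
        ultimately show "p \<in> ?E"
          by blast
      qed
    qed (use range pos Suc_pred in \<open>auto simp: left_partners_def\<close>)
  qed
  also have "\<dots> = 1 + 2 * card ?L"
  proof -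
    \<comment> \<open>Left partners lie below \<open>y\<close> and their mirror images above it, so
      the three parts are disjoint.\<close>
    have "finite ?L" "y \<notin> ?L" "y \<notin> (\<lambda>x. 2 * y - x) ` ?L" "?L \<inter> (\<lambda>x. 2 * y - x) ` ?L = {}"
      using fin by (auto simp: left_partners_def)
    moreover have "inj_on (\<lambda>x. 2 * y - x) ?L"
      by (auto simp: inj_on_def left_partners_def)
    ultimately show ?thesis
      by (simp add: card_Un_disjoint card_image)
  qed
  finally show ?thesis by simp
qed


section \<open>The machine programs\<close>

text \<open>In \<open>square_bound\<close> the term \<open>n * n\<close> covers the running count
  (at most \<open>n\<close> middles with at most \<open>n\<close> partners each). The linear terms
  cover reflected positions, convolution entries, indices and small constants.\<close>

locale bounded_string =
  fixes S :: "int list" and \<sigma> :: int and n :: nat and w :: int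
  assumes length: "length S = n"
    and char_bound: "\<And>c. c \<in> set S \<Longrightarrow> \<bar>c\<bar> \<le> w"
    and \<sigma>_bound: "\<bar>\<sigma>\<bar> \<le> w"
    and square_bound: "int n * int n + 2 * int n + 2 \<le> w"
begin

abbreviation X :: "nat set" where
  "X \<equiv> occurrences S \<sigma>"

lemma linear_bound: "2 * int n + 2 \<le> w"
  using square_bound by (smt (verit) zero_le_square)

lemma char_at_bound: "1 \<le> j \<Longrightarrow> j \<le> n \<Longrightarrow> \<bar>char_at S j\<bar> \<le> w"
  unfolding char_at_def using length by (intro char_bound nth_mem) simp

lemma X_subset: "X \<subseteq> {1..n}"
  using length by (auto simp: occurrences_def)

lemma card_left_partners_le: "card (left_partners X y) \<le> card X"
  by (intro card_mono) (auto simp: left_partners_def)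

lemma card_X_le: "card X \<le> n"
  using card_mono[OF _ X_subset] by simp

end


subsection \<open>Testing all pairs of occurrences\<close>

text \<open>Variable 3 indexes the middle occurrence \<open>y\<close> and variable 4 the first
  occurrence \<open>x\<close>, so this is the mirror image \<open>2 * y - x\<close> of
  \<open>x\<close> in \<open>y\<close>.\<close>

definition reflected :: aexp where
  "reflected = Bin Plus (Get 1 (Var 3)) (Bin Minus (Get 1 (Var 3)) (Get 1 (Var 4)))"

text \<open>The tests are nested because \<open>Conj\<close> evaluates both arguments, and a cell of array 0
  beyond the string may hold an integer that is too large to be read.\<close>

definition test_pair :: com where
  "test_pair =
    Cond (Less (Get 1 (Var 4)) (Get 1 (Var 3)))
      (Cond (Less (Var 0) reflected) Skip
        (Cond (Equal (Get 0 reflected) (Var 1)) (Assign 5 (Bin Plus (Var 5) (Const 1))) Skip))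
      Skip"

definition increment :: "nat \<Rightarrow> com" where
  "increment x = Assign x (Bin Plus (Var x) (Const 1))"

definition test_partners :: com where
  "test_partners =
    Seq (Assign 4 (Const 0))
      (Seq (While (Less (Var 4) (Var 2)) (Seq test_pair (increment 4))) (increment 3))"

definition pair_program :: com where
  "pair_program =
    Seq (Seq (Assign 5 (Const 0)) (Assign 3 (Const 0)))
      (Seq (While (Less (Var 3) (Var 2)) test_partners) (Assign 0 (Var 5)))"

section \<open>Correctness and running time of the test of all pairs\<close>

locale known_occurrences = bounded_string +
  fixes ps :: "nat list"
  assumes distinct: "distinct ps" and set_ps: "set ps = X"
begin

abbreviation m :: nat where
  "m \<equiv> length ps"

lemma m_eq: "m = card X"
  using distinct_card[OF distinct] set_ps by simp

text \<open>The inner index, variable 4, is left out so that the same predicate serves as invariant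
  of the outer loop and, with variable 4 added, of the inner one.\<close>

definition pair_state :: "nat \<Rightarrow> nat \<Rightarrow> state \<Rightarrow> bool" where
  "pair_state i c s \<longleftrightarrow> string_input S \<sigma> s \<and> occurrences_input ps s \<and>
     fst s 3 = int i \<and> fst s 5 = int c"

definition hits :: "nat \<Rightarrow> nat \<Rightarrow> nat" where
  "hits i j = (\<Sum>j'<j. of_bool (ps ! j' \<in> left_partners X (ps ! i)))"

lemma hits_le: "hits i j \<le> j"
  using sum_bounded_above[of "{..<j}" "\<lambda>j'. of_bool (ps ! j' \<in> left_partners X (ps ! i))" "1::nat"]
  by (simp add: hits_def)

lemma sum_nth_ps: "(\<Sum>i<m. f (ps ! i)) = sum f X"
  using sum.reindex_bij_betw[OF bij_betw_nth[OF distinct refl refl], of f] set_ps by simp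

lemma hits_m: "hits i m = card (left_partners X (ps ! i))"
proof -
  have "hits i m = (\<Sum>x\<in>X. of_bool (x \<in> left_partners X (ps ! i)))"
    unfolding hits_def by (rule sum_nth_ps)
  also have "\<dots> = card (left_partners X (ps ! i))"
    by (simp add: left_partners_def Int_def)
  finally show ?thesis .
qed

text \<open>For \<open>x < y\<close> the mirror image is at least 1, so comparing it with the length
  and then reading its character decides whether it is an occurrence. The bound on \<open>c\<close>
  leaves room for one increment.\<close>

lemma wp_test_pair:
  assumes s: "pair_state i c s" "fst s 4 = int j" and i: "i < m" and j: "j < m" and c: "int c + 1 \<le> w"
  shows "wp w (Seq test_pair (increment 4)) s
    (\<lambda>s'. pair_state i (c + of_bool (ps ! j \<in> left_partners X (ps ! i))) s' \<and>
      fst s' 4 = int (Suc j))"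
proof -
  let ?x = "ps ! j" and ?y = "ps ! i"
  have X: "?x \<in> X" "?y \<in> X"
    using i j set_ps nth_mem by blast+
  then have range: "1 \<le> ?x" "?x \<le> n" "1 \<le> ?y" "?y \<le> n"
    using X_subset by auto
  have "m \<le> n"
    using m_eq card_X_le by simp
  have cells: "fst s 0 = int n" "fst s 1 = \<sigma>" "fst s 2 = int m" "fst s 3 = int i"
    "fst s 4 = int j" "fst s 5 = int c" "snd s 1 (int i) = int ?y" "snd s 1 (int j) = int ?x"
    and chars: "\<And>l. 1 \<le> l \<Longrightarrow> l \<le> n \<Longrightarrow> snd s 0 (int l) = char_at S l"
    using s i j length
    by (auto simp: pair_state_def string_input_def occurrences_input_def)
  \<comment> \<open>This subtraction may truncate if \<open>y \<le> x\<close>; every use of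
    \<open>z\<close> below is guarded by \<open>x < y\<close>.\<close>
  define z where "z = 2 * ?y - ?x"
  have index: "int ?y + (int ?y - int ?x) = int z" if "?x < ?y"
    using that by (simp add: z_def)
  have partner: "?x \<in> left_partners X ?y \<longleftrightarrow> ?x < ?y \<and> z \<le> n \<and> char_at S z = \<sigma>"
    using X(1) range length by (auto simp: left_partners_def occurrences_def z_def)
  have pos: "1 \<le> z" if "?x < ?y"
    using that by (simp add: z_def)
  \<comment> \<open>The postcondition fixes the final state completely, so the invariant can be
    transferred to it by substitution.\<close>
  have test: "wp w test_pair s
      (\<lambda>s'. s' = ((fst s)(5 := int (c + of_bool (?x \<in> left_partners X ?y))), snd s))"
  proof (cases "?x < ?y")
    case False
    then show ?thesis
      using range i j \<open>m \<le> n\<close> linear_bound cells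
      by (simp add: test_pair_def partner prod_eq_iff fun_eq_iff)
  next
    case True
    have aval: "aval s reflected = int z"
      by (simp only: reflected_def aval.simps apply_aop.simps cells index[OF True])
    have afits: "afits w s reflected"
      using True range i j \<open>m \<le> n\<close> linear_bound cells by (simp add: reflected_def)
    show ?thesis
    proof (cases "z \<le> n")
      case False
      then show ?thesis
        using True range i j \<open>m \<le> n\<close> linear_bound cells aval afits
        by (simp add: test_pair_def partner prod_eq_iff fun_eq_iff)
    next
      case le: True
      show ?thesis
        using True le range i j \<open>m \<le> n\<close> linear_bound cells aval afits c \<sigma>_bound
          chars[OF pos[OF True] le] char_at_bound[OF pos[OF True] le]
        by (simp add: test_pair_def partner prod_eq_iff fun_eq_iff)
    qed
  qed
  show ?thesis
  proof (simp only: wp.simps, rule wp_mono[OF test])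
    fix s'
    assume s': "s' = ((fst s)(5 := int (c + of_bool (?x \<in> left_partners X ?y))), snd s)"
    show "wp w (increment 4) s'
        (\<lambda>s'. pair_state i (c + of_bool (?x \<in> left_partners X ?y)) s' \<and>
          fst s' 4 = int (Suc j))"
      using s j \<open>m \<le> n\<close> linear_bound
      by (simp add: s' increment_def pair_state_def string_input_def occurrences_input_def)
  qed
qed

text \<open>The count grows by at most \<open>m\<close> during the inner loop, which explains the
  bound on \<open>c\<close>. The constants 50 are the exact costs generously rounded up.\<close>

lemma test_partners:
  assumes s: "pair_state i c s" and i: "i < m" and c: "int c + int m + 1 \<le> w"
  shows "runs_within w (50 + 50 * m) test_partners s (pair_state (Suc i) (c + hits i m))"
proof -
  let ?b = "Less (Var 4) (Var 2)" and ?c = "Seq test_pair (increment 4)"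
  let ?I = "\<lambda>j s. pair_state i (c + hits i j) s \<and> fst s 4 = int j"
  have "m \<le> n"
    using m_eq card_X_le by simp
  have init: "runs_within w (loop_free_time (Assign 4 (Const 0))) (Assign 4 (Const 0)) s (?I 0)"
    using s linear_bound
    by (intro runs_within_wp)
      (simp add: pair_state_def string_input_def occurrences_input_def hits_def)
  have loop: "runs_within w (m * (1 + bcost ?b + loop_free_time ?c) + (1 + bcost ?b))
      (While ?b ?c) s' (?I m)" if "?I 0 s'" for s'
  proof (rule runs_within_While)
    fix j s'
    assume j: "j < m" and s': "?I j s'"
    have "int (c + hits i j) + 1 \<le> w"
      using hits_le[of i j] j c by simp
    from runs_within_wp[OF wp_test_pair[OF conjunct1[OF s'] conjunct2[OF s'] i j this]]
    have "runs_within w (loop_free_time ?c) ?c s' (?I (Suc j))"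
      by (simp add: hits_def add.assoc)
    then show "bfits w s' ?b \<and> bval s' ?b \<and> runs_within w (loop_free_time ?c) ?c s' (?I (Suc j))"
      using s' j \<open>m \<le> n\<close> linear_bound by (simp add: pair_state_def occurrences_input_def)
  qed (use that \<open>m \<le> n\<close> linear_bound in
      \<open>auto simp: pair_state_def occurrences_input_def\<close>)
  have step: "runs_within w (loop_free_time (increment 3)) (increment 3) s'
      (pair_state (Suc i) (c + hits i m))" if "?I m s'" for s'
    using that i \<open>m \<le> n\<close> linear_bound
    by (intro runs_within_wp)
      (simp add: increment_def pair_state_def string_input_def occurrences_input_def)
  have "runs_within w (loop_free_time (Assign 4 (Const 0)) +
      (m * (1 + bcost ?b + loop_free_time ?c) + (1 + bcost ?b) + loop_free_time (increment 3)))
      test_partners s (pair_state (Suc i) (c + hits i m))"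
    unfolding test_partners_def by (rule runs_within_Seq[OF init runs_within_Seq[OF loop step]])
  then show ?thesis
    by (rule runs_within_mono)
      (simp_all add: test_pair_def reflected_def increment_def algebra_simps)
qed

lemma pair_program:
  assumes "string_input S \<sigma> s" "occurrences_input ps s"
  shows "runs_within w (100 + m * (100 + m * 50)) pair_program s (returns_count3 S \<sigma>)"
proof -
  let ?b = "Less (Var 3) (Var 2)"
  let ?init = "Seq (Assign 5 (Const 0)) (Assign 3 (Const 0))"
  define total where "total i = (\<Sum>i'<i. hits i' m)" for i
  let ?I = "\<lambda>i. pair_state i (total i)"
  have "m \<le> n"
    using m_eq card_X_le by simp
  \<comment> \<open>Each middle contributes at most \<open>m\<close> hits. With
    \<open>m \<le> n\<close> the count never exceeds \<open>n * n\<close>, which is where the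
    quadratic word bound enters.\<close>
  have total_le: "total i \<le> i * m" for i
    unfolding total_def using sum_bounded_above[of "{..<i}" "\<lambda>i'. hits i' m" m] hits_le by simp
  have total_bound: "int (total i) + int m + 1 \<le> w" if "i \<le> m" for i
  proof -
    have "total i \<le> n * n"
      using total_le[of i] mult_le_mono[of i n m n] that \<open>m \<le> n\<close> by simp
    then have "int (total i) \<le> int n * int n"
      by (metis of_nat_le_iff of_nat_mult)
    then show ?thesis
      using \<open>m \<le> n\<close> square_bound by simp
  qed
  have total_m: "total m = card (sub_cadences3_with S \<sigma>)"
    unfolding total_def hits_m card_sub_cadences3_with
    using sum_nth_ps[of "\<lambda>y. card (left_partners X y)"] .
  have init: "runs_within w (loop_free_time ?init) ?init s (?I 0)"
    using assms linear_bound
    by (intro runs_within_wp)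
      (simp add: pair_state_def string_input_def occurrences_input_def total_def)
  have loop: "runs_within w (m * (1 + bcost ?b + (50 + 50 * m)) + (1 + bcost ?b))
      (While ?b test_partners) s' (?I m)" if "?I 0 s'" for s'
  proof (rule runs_within_While)
    fix i s'
    assume i: "i < m" and s': "?I i s'"
    have "runs_within w (50 + 50 * m) test_partners s' (?I (Suc i))"
      using test_partners[OF s' i total_bound] i by (simp add: total_def)
    then show "bfits w s' ?b \<and> bval s' ?b \<and>
        runs_within w (50 + 50 * m) test_partners s' (?I (Suc i))"
      using s' i \<open>m \<le> n\<close> linear_bound by (simp add: pair_state_def occurrences_input_def)
  qed (use that \<open>m \<le> n\<close> linear_bound in
      \<open>auto simp: pair_state_def occurrences_input_def\<close>)
  have result: "runs_within w (loop_free_time (Assign 0 (Var 5))) (Assign 0 (Var 5)) s'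
      (returns_count3 S \<sigma>)" if "?I m s'" for s'
    using that total_bound[of m]
    by (intro runs_within_wp) (simp add: pair_state_def returns_count3_def total_m)
  have "runs_within w (loop_free_time ?init +
      (m * (1 + bcost ?b + (50 + 50 * m)) + (1 + bcost ?b) + loop_free_time (Assign 0 (Var 5))))
      pair_program s (returns_count3 S \<sigma>)"
    unfolding pair_program_def by (rule runs_within_Seq[OF init runs_within_Seq[OF loop result]])
  then show ?thesis
    by (rule runs_within_mono) (simp_all add: algebra_simps)
qed

end


subsection \<open>Reading the counts off a convolution\<close>

text \<open>The convolution program may overwrite everything it mentions. The variables
  \<open>v, \<dots>, v + 3\<close> and the array \<open>f\<close> are chosen fresh, so that the length of the string and the
  indicator sequence of the occurrences survive.\<close>

definition write_indicator :: "nat \<Rightarrow> nat \<Rightarrow> com" where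
  "write_indicator v f =
    Seq (Cond (Equal (Get 0 (Bin Plus (Var (v + 1)) (Const 1))) (Var 1))
          (Assign (v + 3) (Const 1)) (Assign (v + 3) (Const 0)))
      (Seq (Put 0 (Var (v + 1)) (Var (v + 3))) (Seq (Put 1 (Var (v + 1)) (Var (v + 3)))
        (Seq (Put f (Var (v + 1)) (Var (v + 3))) (increment (v + 1)))))"

text \<open>At an occurrence the entry has the form \<open>1 + 2 * c\<close>, where \<open>c\<close>
  is the number of left partners; subtracting 1 and halving recovers \<open>c\<close>. The saved
  indicator in array \<open>f\<close> selects these entries.\<close>

definition add_convolution_entry :: "nat \<Rightarrow> nat \<Rightarrow> com" where
  "add_convolution_entry v f =
    Seq (Cond (Equal (Get f (Var (v + 1))) (Const 1))
          (Assign (v + 2) (Bin Plus (Var (v + 2))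
            (Bin Div (Bin Minus (Get 2 (Bin Plus (Var (v + 1)) (Var (v + 1)))) (Const 1)) (Const 2))))
          Skip)
      (increment (v + 1))"

text \<open>Variable \<open>v\<close> saves the length, \<open>v + 1\<close> is the index of both
  loops, \<open>v + 2\<close> accumulates the count, and \<open>v + 3\<close> holds the current
  indicator bit.\<close>

definition convolution_program :: "nat \<Rightarrow> nat \<Rightarrow> com \<Rightarrow> com" where
  "convolution_program v f P =
    Seq (Seq (Assign v (Var 0)) (Assign (v + 1) (Const 0)))
      (Seq (While (Less (Var (v + 1)) (Var v)) (write_indicator v f))
        (Seq P
          (Seq (Seq (Assign (v + 2) (Const 0)) (Assign (v + 1) (Const 0)))
            (Seq (While (Less (Var (v + 1)) (Var v)) (add_convolution_entry v f))
              (Assign 0 (Var (v + 2)))))))"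

section \<open>Correctness and running time of the convolution method\<close>

context bounded_string
begin

definition indicator_list :: "int list" where
  "indicator_list = map (\<lambda>i. of_bool (Suc i \<in> X)) [0..<n]"

text \<open>The string is overwritten in place: array 0 holds the indicator below cell
  \<open>i\<close> and still the string above it. Cell \<open>i\<close> itself is left open: its
  character has been read already, and cell 0 never held one.\<close>

definition write_state :: "nat \<Rightarrow> nat \<Rightarrow> nat \<Rightarrow> state \<Rightarrow> bool" where
  "write_state v f i s \<longleftrightarrow> fst s 0 = int n \<and> fst s 1 = \<sigma> \<and> fst s v = int n \<and>
     fst s (v + 1) = int i \<and>
     (\<forall>a\<in>{0, 1, f}. \<forall>j<i. snd s a (int j) = of_bool (Suc j \<in> X)) \<and>
     (\<forall>j. i < j \<and> j \<le> n \<longrightarrow> snd s 0 (int j) = char_at S j)"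

text \<open>Iteration \<open>i\<close> reads cell \<open>i + 1\<close> and writes cell
  \<open>i\<close>, so the characters to come stay intact. The bounds on \<open>v\<close> and
  \<open>f\<close> keep the auxiliary memory apart from the input.\<close>

lemma write_indicator:
  assumes s: "write_state v f i s" and i: "i < n" and v: "v > 2" and f: "f > 2"
  shows "wp w (write_indicator v f) s (write_state v f (Suc i))"
proof -
  have next_char: "snd s 0 (1 + int i) = char_at S (Suc i)"
    using s i by (metis Suc_leI lessI of_nat_Suc write_state_def)
  have "Suc i \<in> X \<longleftrightarrow> char_at S (Suc i) = \<sigma>"
    using i length by (simp add: occurrences_def)
  moreover have "\<bar>char_at S (Suc i)\<bar> \<le> w"
    using i by (intro char_at_bound) auto
  ultimately show ?thesis
    using s i v f linear_bound \<sigma>_bound next_char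
    by (auto simp: write_indicator_def increment_def write_state_def less_Suc_eq add.commute)
qed

text \<open>Array 2 is described through \<open>left_partners\<close> rather than as a convolution,
  and only at occurrences, where its entries have the form \<open>1 + 2 * c\<close>.\<close>

definition add_state :: "nat \<Rightarrow> nat \<Rightarrow> nat \<Rightarrow> state \<Rightarrow> bool" where
  "add_state v f i s \<longleftrightarrow> fst s v = int n \<and> fst s (v + 1) = int i \<and>
     fst s (v + 2) = (\<Sum>j<i. if Suc j \<in> X then int (card (left_partners X (Suc j))) else 0) \<and>
     (\<forall>j<n. snd s f (int j) = of_bool (Suc j \<in> X)) \<and>
     (\<forall>j<n. Suc j \<in> X \<longrightarrow> snd s 2 (int (2 * j)) = 1 + 2 * int (card (left_partners X (Suc j))))"

text \<open>There are at most \<open>n\<close> summands, each at most \<open>n\<close>. Both signs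
  matter because the machine limits absolute values.\<close>

lemma partial_count_bounds:
  assumes "i \<le> n"
  shows "0 \<le> (\<Sum>j<i. if Suc j \<in> X then int (card (left_partners X (Suc j))) else 0)"
    and "(\<Sum>j<i. if Suc j \<in> X then int (card (left_partners X (Suc j))) else 0) \<le> w"
proof -
  let ?f = "\<lambda>j. if Suc j \<in> X then int (card (left_partners X (Suc j))) else 0"
  show "0 \<le> sum ?f {..<i}"
    by (intro sum_nonneg) simp
  have "?f j \<le> int n" for j
    using card_left_partners_le[of "Suc j"] card_X_le by simp
  then have "sum ?f {..<i} \<le> int i * int n"
    using sum_bounded_above[of "{..<i}" ?f "int n"] by simp
  also have "\<dots> \<le> int n * int n"
    using assms by (intro mult_right_mono) auto
  finally show "sum ?f {..<i} \<le> w"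
    using square_bound by simp
qed

lemma add_convolution_entry:
  assumes s: "add_state v f i s" and i: "i < n" and v: "v > 2"
  shows "wp w (add_convolution_entry v f) s (add_state v f (Suc i))"
proof -
  let ?c = "card (left_partners X (Suc i))"
  have entry: "snd s 2 (int i + int i) = 1 + 2 * int ?c" if "Suc i \<in> X"
  proof -
    have "int i + int i = int (2 * i)"
      by simp
    moreover have "snd s 2 (int (2 * i)) = 1 + 2 * int ?c"
      using s i that unfolding add_state_def by blast
    ultimately show ?thesis
      by metis
  qed
  have "?c \<le> n"
    using card_left_partners_le[of "Suc i"] card_X_le by simp
  then show ?thesis
    using s i v linear_bound entry partial_count_bounds[of i] partial_count_bounds[of "Suc i"]
    by (cases "Suc i \<in> X") (auto simp: add_convolution_entry_def increment_def add_state_def)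
qed

lemma sum_positions: "(\<Sum>j<n. if Suc j \<in> X then f (Suc j) else 0) = sum f X"
proof -
  have "(\<Sum>j<n. if Suc j \<in> X then f (Suc j) else 0) = (\<Sum>y\<in>Suc ` {..<n}. if y \<in> X then f y else 0)"
    by (simp add: sum.reindex)
  also have "\<dots> = sum f (Suc ` {..<n} \<inter> X)"
    by (simp add: sum.inter_restrict)
  also have "Suc ` {..<n} \<inter> X = X"
    using X_subset by (auto simp: image_Suc_lessThan)
  finally show ?thesis .
qed

text \<open>\<open>P\<close> is any program that convolves the indicator list with itself. The
  hypotheses on \<open>v\<close> and \<open>f\<close> say that it does not touch the saved length
  and the saved indicator.\<close>

lemma convolution_program:
  assumes v: "v > 2" "\<And>x. x \<in> assigned_vars P \<Longrightarrow> x < v"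
    and f: "f > 2" "f \<notin> assigned_arrays P"
    and P: "\<And>s. convolution_input indicator_list indicator_list s \<Longrightarrow>
      runs_within w t P s (\<lambda>s'. \<forall>l. l + 1 < 2 * n \<longrightarrow>
        snd s' 2 (int l) = acyclic_convolution indicator_list indicator_list l)"
    and s: "string_input S \<sigma> s"
  shows "runs_within w (t + 100 * n + 100) (convolution_program v f P) s (returns_count3 S \<sigma>)"
proof -
  let ?b = "Less (Var (v + 1)) (Var v)"
  let ?init = "Seq (Assign v (Var 0)) (Assign (v + 1) (Const 0))"
  let ?init' = "Seq (Assign (v + 2) (Const 0)) (Assign (v + 1) (Const 0))"
  let ?write = "write_indicator v f" and ?add = "add_convolution_entry v f"
  \<comment> \<open>This is what the second loop requires from the memory left by \<open>P\<close>;
    the variables \<open>v + 1\<close> and \<open>v + 2\<close> are reset by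
    \<open>?init'\<close>.\<close>
  let ?R = "\<lambda>s. fst s v = int n \<and> (\<forall>j<n. snd s f (int j) = of_bool (Suc j \<in> X)) \<and>
     (\<forall>j<n. Suc j \<in> X \<longrightarrow> snd s 2 (int (2 * j)) = 1 + 2 * int (card (left_partners X (Suc j))))"
  have init: "runs_within w (loop_free_time ?init) ?init s (write_state v f 0)"
    using s v linear_bound length
    by (intro runs_within_wp) (simp add: string_input_def write_state_def)
  have fill: "runs_within w (n * (1 + bcost ?b + loop_free_time ?write) + (1 + bcost ?b))
      (While ?b ?write) s' (write_state v f n)" if "write_state v f 0 s'" for s'
  proof (rule runs_within_While[where I = "write_state v f"])
    fix i s'
    assume "i < n" "write_state v f i s'"
    then show "bfits w s' ?b \<and> bval s' ?b \<and>
        runs_within w (loop_free_time ?write) ?write s' (write_state v f (Suc i))"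
      using runs_within_wp[OF write_indicator[of v f i s']] v f linear_bound
      by (simp add: write_state_def)
  qed (use that linear_bound in \<open>auto simp: write_state_def\<close>)
  have convolve: "runs_within w t P s' ?R" if s': "write_state v f n s'" for s'
  proof -
    have "convolution_input indicator_list indicator_list s'"
      using s' by (simp add: convolution_input_def indicator_list_def write_state_def)
    from runs_within_frame[OF P[OF this]] show ?thesis
    proof (rule runs_within_mono)
      fix s''
      assume s'': "(\<forall>l. l + 1 < 2 * n \<longrightarrow>
          snd s'' 2 (int l) = acyclic_convolution indicator_list indicator_list l) \<and>
        (\<forall>x. x \<notin> assigned_vars P \<longrightarrow> fst s'' x = fst s' x) \<and>
        (\<forall>a. a \<notin> assigned_arrays P \<longrightarrow> snd s'' a = snd s' a)"
      have "fst s'' v = int n"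
        using s' s'' v(2) by (metis less_irrefl write_state_def)
      moreover have "snd s'' f (int j) = of_bool (Suc j \<in> X)" if "j < n" for j
        using s' s'' f(2) that by (simp add: write_state_def)
      moreover have "snd s'' 2 (int (2 * j)) = 1 + 2 * int (card (left_partners X (Suc j)))"
        if "j < n" "Suc j \<in> X" for j
      proof -
        have "2 * j + 1 < 2 * n"
          using \<open>j < n\<close> by simp
        then have "snd s'' 2 (int (2 * j)) = acyclic_convolution indicator_list indicator_list (2 * j)"
          using s'' by blast
        then show ?thesis
          using acyclic_convolution_indicator[OF X_subset \<open>Suc j \<in> X\<close>]
          by (simp add: indicator_list_def)
      qed
      ultimately show "?R s''"
        by blast
    qed simp_all
  qed
  have init': "runs_within w (loop_free_time ?init') ?init' s' (add_state v f 0)" if "?R s'" for s'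
    using that v linear_bound by (intro runs_within_wp) (simp add: add_state_def)
  have add: "runs_within w (n * (1 + bcost ?b + loop_free_time ?add) + (1 + bcost ?b))
      (While ?b ?add) s' (add_state v f n)" if "add_state v f 0 s'" for s'
  proof (rule runs_within_While[where I = "add_state v f"])
    fix i s'
    assume "i < n" "add_state v f i s'"
    then show "bfits w s' ?b \<and> bval s' ?b \<and>
        runs_within w (loop_free_time ?add) ?add s' (add_state v f (Suc i))"
      using runs_within_wp[OF add_convolution_entry[of v f i s']] v linear_bound
      by (simp add: add_state_def)
  qed (use that linear_bound in \<open>auto simp: add_state_def\<close>)
  have result: "runs_within w (loop_free_time (Assign 0 (Var (v + 2)))) (Assign 0 (Var (v + 2))) s'
      (returns_count3 S \<sigma>)" if "add_state v f n s'" for s'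
    using that partial_count_bounds[of n]
      sum_positions[of "\<lambda>y. int (card (left_partners X y))"]
    by (intro runs_within_wp)
      (simp add: add_state_def returns_count3_def card_sub_cadences3_with)
  have "runs_within w (loop_free_time ?init +
      (n * (1 + bcost ?b + loop_free_time ?write) + (1 + bcost ?b) +
      (t + (loop_free_time ?init' +
      (n * (1 + bcost ?b + loop_free_time ?add) + (1 + bcost ?b) +
      loop_free_time (Assign 0 (Var (v + 2))))))))
      (convolution_program v f P) s (returns_count3 S \<sigma>)"
    unfolding convolution_program_def
    by (rule runs_within_Seq[OF init runs_within_Seq[OF fill runs_within_Seq[OF convolve
        runs_within_Seq[OF init' runs_within_Seq[OF add result]]]]])
  then show ?thesis
    by (rule runs_within_mono)
      (simp_all add: write_indicator_def add_convolution_entry_def increment_def algebra_simps)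
qed

end

section \<open>Polynomial word bounds and asymptotic running times\<close>

lemma bounded_string_power:
  assumes "length S = n" "set S \<subseteq> A" "small_alphabet k n A" "\<sigma> \<in> A"
  shows "bounded_string S \<sigma> n ((int n + 2) ^ (k + k' + 2))"
proof
  have 1: "(1::int) \<le> (int n + 2) ^ l" for l
    by (rule one_le_power) simp
  have chars: "\<bar>c\<bar> \<le> (int n + 2) ^ (k + k' + 2)" if "c \<in> A" for c
  proof -
    have "\<bar>c\<bar> \<le> (int n + 2) ^ k"
      using assms(3) that by (simp add: small_alphabet_def)
    also have "\<dots> \<le> (int n + 2) ^ (k + k' + 2)"
      by (intro power_increasing) auto
    finally show ?thesis .
  qed
  then show "\<bar>\<sigma>\<bar> \<le> (int n + 2) ^ (k + k' + 2)"
    and "\<And>c. c \<in> set S \<Longrightarrow> \<bar>c\<bar> \<le> (int n + 2) ^ (k + k' + 2)"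
    using assms by blast+
  \<comment> \<open>In the exponent, 2 pays for the quadratic count, \<open>k\<close> for the
    characters, and \<open>k'\<close> leaves room for the convolution program.\<close>
  have "int n * int n + 2 * int n + 2 \<le> (int n + 2) ^ 2"
    by (simp add: power2_eq_square algebra_simps)
  also have "\<dots> \<le> (int n + 2) ^ (k + k' + 2)"
    by (intro power_increasing) auto
  finally show "int n * int n + 2 * int n + 2 \<le> (int n + 2) ^ (k + k' + 2)" .
qed (fact assms(1))

theorem theorem3:
  "(fast_convolution \<longrightarrow>
     (\<exists>P T. (\<lambda>n. real (T n)) \<in> O(\<lambda>n. real n * ln (real n)) \<and>
       (\<forall>k. \<exists>k'. \<forall>(A :: int set) S n \<sigma> s.
          length S = n \<longrightarrow> set S \<subseteq> A \<longrightarrow> small_alphabet k n A \<longrightarrow> \<sigma> \<in> A \<longrightarrow>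
          string_input S \<sigma> s \<longrightarrow>
          runs_within ((int n + 2) ^ k') (T n) P s (returns_count3 S \<sigma>)))) \<and>
   (\<exists>P T. (\<lambda>m. real (T m)) \<in> O(\<lambda>m. real m ^ 2) \<and>
       (\<forall>k. \<exists>k'. \<forall>(A :: int set) S n \<sigma> ps s.
          length S = n \<longrightarrow> set S \<subseteq> A \<longrightarrow> small_alphabet k n A \<longrightarrow> \<sigma> \<in> A \<longrightarrow>
          distinct ps \<longrightarrow> set ps = occurrences S \<sigma> \<longrightarrow>
          string_input S \<sigma> s \<longrightarrow> occurrences_input ps s \<longrightarrow>
          runs_within ((int n + 2) ^ k') (T (card (occurrences S \<sigma>))) P s (returns_count3 S \<sigma>)))"
proof (intro conjI impI)
  assume fast_convolution
  \<comment> \<open>The instance with exponent 0 suffices: entries of an indicator list are 0 or 1,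
    hence bounded by \<open>(int m + 2) ^ 0\<close>.\<close>
  then obtain P T k' where T: "(\<lambda>m. real (T m)) \<in> O(\<lambda>m. real m * ln (real m))"
    and P: "\<forall>a b s m. length a = m \<longrightarrow> length b = m \<longrightarrow>
      (\<forall>x\<in>set a \<union> set b. \<bar>x\<bar> \<le> (int m + 2) ^ 0) \<longrightarrow> convolution_input a b s \<longrightarrow>
      runs_within ((int m + 2) ^ k') (T m) P s
        (\<lambda>s'. \<forall>l. l + 1 < 2 * m \<longrightarrow> snd s' 2 (int l) = acyclic_convolution a b l)"
    unfolding fast_convolution_def by (elim allE[of _ 0] exE conjE) (rule that)
  \<comment> \<open>Inserting 2 makes the set nonempty, so that \<open>Max\<close> is meaningful,
    and yields names beyond the fixed ones 0, 1 and 2.\<close>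
  define v where "v = Suc (Max (insert 2 (assigned_vars P)))"
  define f where "f = Suc (Max (insert 2 (assigned_arrays P)))"
  have v: "v > 2" "\<And>x. x \<in> assigned_vars P \<Longrightarrow> x < v"
    unfolding v_def using finite_assigned(1)[of P] by (simp_all add: less_Suc_eq_le)
  have "f > 2" "\<And>x. x \<in> assigned_arrays P \<Longrightarrow> x < f"
    unfolding f_def using finite_assigned(2)[of P] by (simp_all add: less_Suc_eq_le)
  then have f: "f > 2" "f \<notin> assigned_arrays P"
    by auto
  \<comment> \<open>The work around \<open>P\<close> is linear and thus absorbed by
    \<open>n * ln n\<close>.\<close>
  have "(\<lambda>n. 100 * real n + 100) \<in> O(\<lambda>n. real n * ln (real n))"
    by real_asymp
  from sum_in_bigo(1)[OF T this]
  have time: "(\<lambda>n. real (T n + 100 * n + 100)) \<in> O(\<lambda>n. real n * ln (real n))"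
    by (simp add: add.assoc)
  have count: "runs_within ((int n + 2) ^ (k + k' + 2)) (T n + 100 * n + 100) (convolution_program v f P) s
      (returns_count3 S \<sigma>)"
    if "length S = n" "set S \<subseteq> A" "small_alphabet k n A" "\<sigma> \<in> A" "string_input S \<sigma> s"
    for k A S n \<sigma> s
  proof -
    interpret bounded_string S \<sigma> n "(int n + 2) ^ (k + k' + 2)"
      using that(1-4) by (rule bounded_string_power)
    have "runs_within ((int n + 2) ^ (k + k' + 2)) (T n) P s (\<lambda>s'. \<forall>l. l + 1 < 2 * n \<longrightarrow>
        snd s' 2 (int l) = acyclic_convolution indicator_list indicator_list l)"
      if "convolution_input indicator_list indicator_list s" for s
    proof -
      have "(int n + 2) ^ k' \<le> (int n + 2) ^ (k + k' + 2)"
        by (intro power_increasing) auto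
      moreover have "runs_within ((int n + 2) ^ k') (T n) P s (\<lambda>s'. \<forall>l. l + 1 < 2 * n \<longrightarrow>
          snd s' 2 (int l) = acyclic_convolution indicator_list indicator_list l)"
        using that by (intro P[rule_format]) (auto simp: indicator_list_def)
      ultimately show ?thesis
        by (auto intro: runs_within_mono)
    qed
    from convolution_program[OF v f this \<open>string_input S \<sigma> s\<close>] show ?thesis .
  qed
  show "\<exists>P T. (\<lambda>n. real (T n)) \<in> O(\<lambda>n. real n * ln (real n)) \<and>
       (\<forall>k. \<exists>k'. \<forall>(A :: int set) S n \<sigma> s.
          length S = n \<longrightarrow> set S \<subseteq> A \<longrightarrow> small_alphabet k n A \<longrightarrow> \<sigma> \<in> A \<longrightarrow>
          string_input S \<sigma> s \<longrightarrow>
          runs_within ((int n + 2) ^ k') (T n) P s (returns_count3 S \<sigma>))"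
  \<comment> \<open>The program and its time are chosen before \<open>k\<close>: a larger alphabet
    affects only the exponent of the word bound.\<close>
  proof (intro exI[of _ "convolution_program v f P"] exI[of _ "\<lambda>n. T n + 100 * n + 100"]
      conjI allI)
    fix k
    show "\<exists>k'. \<forall>(A :: int set) S n \<sigma> s.
        length S = n \<longrightarrow> set S \<subseteq> A \<longrightarrow> small_alphabet k n A \<longrightarrow> \<sigma> \<in> A \<longrightarrow>
        string_input S \<sigma> s \<longrightarrow>
        runs_within ((int n + 2) ^ k') (T n + 100 * n + 100) (convolution_program v f P) s
          (returns_count3 S \<sigma>)"
      by (intro exI[of _ "k + k' + 2"] allI impI) (rule count)
  qed (fact time)
next
  have time: "(\<lambda>m. real (100 + m * (100 + m * 50))) \<in> O(\<lambda>m. real m ^ 2)"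
    unfolding of_nat_add of_nat_mult of_nat_numeral by real_asymp
  \<comment> \<open>No convolution program is called here, so the exponent reserved for it is
    0.\<close>
  have count: "runs_within ((int n + 2) ^ (k + 0 + 2))
      (100 + card (occurrences S \<sigma>) * (100 + card (occurrences S \<sigma>) * 50)) pair_program s
      (returns_count3 S \<sigma>)"
    if "length S = n" "set S \<subseteq> A" "small_alphabet k n A" "\<sigma> \<in> A"
      "distinct ps" "set ps = occurrences S \<sigma>" "string_input S \<sigma> s" "occurrences_input ps s"
    for k A S n \<sigma> ps s
  proof -
    interpret bounded_string S \<sigma> n "(int n + 2) ^ (k + 0 + 2)"
      using that(1-4) by (rule bounded_string_power)
    interpret known_occurrences S \<sigma> n "(int n + 2) ^ (k + 0 + 2)" ps
      using that(5,6) by unfold_locales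
    from pair_program[OF that(7,8)] show ?thesis
      unfolding m_eq .
  qed
  show "\<exists>P T. (\<lambda>m. real (T m)) \<in> O(\<lambda>m. real m ^ 2) \<and>
       (\<forall>k. \<exists>k'. \<forall>(A :: int set) S n \<sigma> ps s.
          length S = n \<longrightarrow> set S \<subseteq> A \<longrightarrow> small_alphabet k n A \<longrightarrow> \<sigma> \<in> A \<longrightarrow>
          distinct ps \<longrightarrow> set ps = occurrences S \<sigma> \<longrightarrow>
          string_input S \<sigma> s \<longrightarrow> occurrences_input ps s \<longrightarrow>
          runs_within ((int n + 2) ^ k') (T (card (occurrences S \<sigma>))) P s (returns_count3 S \<sigma>))"
  proof (intro exI[of _ pair_program] exI[of _ "\<lambda>m. 100 + m * (100 + m * 50)"] conjI allI)
    fix k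
    show "\<exists>k'. \<forall>(A :: int set) S n \<sigma> ps s.
        length S = n \<longrightarrow> set S \<subseteq> A \<longrightarrow> small_alphabet k n A \<longrightarrow> \<sigma> \<in> A \<longrightarrow>
        distinct ps \<longrightarrow> set ps = occurrences S \<sigma> \<longrightarrow>
        string_input S \<sigma> s \<longrightarrow> occurrences_input ps s \<longrightarrow>
        runs_within ((int n + 2) ^ k')
          (100 + card (occurrences S \<sigma>) * (100 + card (occurrences S \<sigma>) * 50)) pair_program s
          (returns_count3 S \<sigma>)"
      by (intro exI[of _ "k + 0 + 2"] allI impI) (rule count)
  qed (fact time)
qed

end
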